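(* Let $a,d,k$ be positive integers, where $k$ is odd and $\gcd(d,k)=1$. Define \[ S(a,d;k):=\sum_{i=1}^{k}(a+(i-1)d)^k=a^k+(a+d)^k+\cdots+(a+(k-1)d)^k. \] Then $S(a,d;k)\equiv 0\pmod{k^2}$. *)

theory Defs
  imports "HOL-Number_Theory.Cong"
begin

definition S :: "nat \<Rightarrow> nat \<Rightarrow> nat \<Rightarrow> nat" where
  "S a d k = (\<Sum>i=1..k. (a + (i - 1) * d) ^ k)"

end

theory Submission
  imports Defs
begin

text \<open>
  Modulo \<open>k\<^sup>2\<close> the power \<open>x ^ k\<close> depends only on \<open>x\<close> modulo \<open>k\<close>, and any progression of
  length \<open>k\<close> with difference coprime to \<open>k\<close> meets every residue class once. So the sum is
  congruent to \<open>T = \<Sum>r<k. r ^ k\<close>; the progression with difference \<open>-1\<close> gives \<open>T \<equiv> -T\<close>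
  because \<open>k\<close> is odd, and \<open>2\<close> is invertible modulo \<open>k\<^sup>2\<close>.
\<close>

text \<open>\<open>x ^ k - y ^ k\<close> is \<open>x - y\<close> times a sum of \<open>k\<close>
  terms, each congruent to \<open>y ^ (k - 1)\<close> modulo \<open>k\<close>; hence
  \<open>k\<close> divides both factors.\<close>

lemma cong_power_modulus_square:
  fixes x y :: int
  assumes "[x = y] (mod int k)"
  shows "[x ^ k = y ^ k] (mod (int k)\<^sup>2)"
proof -
  have "[(\<Sum>i<k. y ^ (k - Suc i) * x ^ i) = (\<Sum>i<k. y ^ (k - Suc i) * y ^ i)] (mod int k)"
    by (intro cong_sum cong_mult cong_refl cong_pow assms)
  also have "(\<Sum>i<k. y ^ (k - Suc i) * y ^ i) = (\<Sum>i<k. y ^ (k - 1))"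
    by (intro sum.cong) (auto simp flip: power_add)
  also have "\<dots> = int k * y ^ (k - 1)"
    by simp
  also have "[\<dots> = 0] (mod int k)"
    by (simp add: cong_0_iff)
  finally have "int k dvd (\<Sum>i<k. y ^ (k - Suc i) * x ^ i)"
    by (simp add: cong_0_iff)
  moreover have "int k dvd x - y"
    using assms by (simp add: cong_iff_dvd_diff)
  ultimately have "int k * int k dvd (x - y) * (\<Sum>i<k. y ^ (k - Suc i) * x ^ i)"
    by (intro mult_dvd_mono)
  then show ?thesis
    by (simp add: cong_iff_dvd_diff power_diff_sumr2 power2_eq_square)
qed

text \<open>Cancelling \<open>a\<close> and the invertible \<open>d\<close> modulo \<open>k\<close>
  gives injectivity; an injective self-map of a finite set is onto.\<close>

lemma progression_mod_bij_betw:
  fixes a d :: int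
  assumes "k > 0" and "coprime d (int k)"
  shows "bij_betw (\<lambda>i. nat ((a + int i * d) mod int k)) {..<k} {..<k}"
proof -
  let ?g = "\<lambda>i. nat ((a + int i * d) mod int k)"
  have "inj_on ?g {..<k}"
  proof (rule inj_onI)
    fix i j
    assume ij: "i \<in> {..<k}" "j \<in> {..<k}" and "?g i = ?g j"
    \<comment> \<open>Remainders modulo a positive \<open>k\<close> are nonnegative, so
      \<open>nat\<close> identifies no two of them.\<close>
    then have "[a + int i * d = a + int j * d] (mod int k)"
      using assms(1) by (simp add: cong_def nat_eq_iff)
    then have "[int i = int j] (mod int k)"
      using assms(2) by (simp add: cong_add_lcancel cong_mult_rcancel)
    then show "i = j"
      using ij by (simp add: cong_def)
  qed
  moreover have "?g ` {..<k} \<subseteq> {..<k}"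
    using assms(1) by (auto simp: nat_less_iff)
  ultimately show ?thesis
    by (simp add: bij_betw_def endo_inj_surj)
qed

text \<open>Stated over \<open>int\<close> so that it covers both the given progression and the one
  with difference \<open>-1\<close>.\<close>

lemma sum_progression_power_cong:
  fixes a d :: int
  assumes "k > 0" and "coprime d (int k)"
  shows "[(\<Sum>i<k. (a + int i * d) ^ k) = (\<Sum>r<k. int r ^ k)] (mod (int k)\<^sup>2)"
proof -
  have "[(\<Sum>i<k. (a + int i * d) ^ k) = (\<Sum>i<k. int (nat ((a + int i * d) mod int k)) ^ k)]
      (mod (int k)\<^sup>2)"
    using assms(1) by (intro cong_sum cong_power_modulus_square) (simp add: cong_def)
  also have "(\<Sum>i<k. int (nat ((a + int i * d) mod int k)) ^ k) = (\<Sum>r<k. int r ^ k)"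
    by (rule sum.reindex_bij_betw[OF progression_mod_bij_betw[OF assms]])
  finally show ?thesis .
qed

lemma sum_residues_power_cong_0:
  assumes "odd k"
  shows "[(\<Sum>r<k. int r ^ k) = 0] (mod (int k)\<^sup>2)"
proof -
  have "k > 0"
    using assms by (rule odd_pos)
  then have "[(\<Sum>r<k. (0 + int r * (-1)) ^ k) = (\<Sum>r<k. int r ^ k)] (mod (int k)\<^sup>2)"
    by (intro sum_progression_power_cong) auto
  also have "(\<Sum>r<k. (0 + int r * (-1)) ^ k) = - (\<Sum>r<k. int r ^ k)"
    using assms by (simp add: sum_negf)
  finally have "(int k)\<^sup>2 dvd 2 * (\<Sum>r<k. int r ^ k)"
    by (simp add: cong_iff_dvd_diff)
  moreover have "coprime ((int k)\<^sup>2) 2"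
    using assms by simp
  ultimately show ?thesis
    by (simp add: cong_0_iff coprime_dvd_mult_right_iff)
qed

theorem theorem4p2:
  fixes a d k :: nat
  assumes "a > 0" and "d > 0" and "k > 0"
    and "odd k" and "gcd d k = 1"
  shows "[S a d k = 0] (mod k\<^sup>2)"
proof -
  have "S a d k = (\<Sum>i<k. (a + i * d) ^ k)"
    \<comment> \<open>The original index starts at 1, so the truncated \<open>i - 1\<close> is a
      true predecessor, inverse to \<open>Suc\<close>.\<close>
    unfolding S_def by (rule sum.reindex_bij_witness[of _ Suc "\<lambda>i. i - 1"]) auto
  then have "int (S a d k) = (\<Sum>i<k. (int a + int i * int d) ^ k)"
    by simp
  also have "[\<dots> = (\<Sum>r<k. int r ^ k)] (mod (int k)\<^sup>2)"
    using assms by (intro sum_progression_power_cong) (simp_all add: coprime_iff_gcd_eq_1)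
  also have "[(\<Sum>r<k. int r ^ k) = 0] (mod (int k)\<^sup>2)"
    using assms(4) by (rule sum_residues_power_cong_0)
  finally have "[int (S a d k) = int 0] (mod int (k\<^sup>2))"
    by simp
  then show ?thesis
    by (simp only: cong_int_iff)
qed

end
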